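(* Let $Y$ be a glued limit space of a sequence of open Riemannian manifolds $M_j$, constructed from a decreasing sequence $\delta_i\to0$ and subsequential limit isometric embeddings $\varphi_{\delta_{i+1},\delta_i}:Y^{\delta_i}\to Y^{\delta_{i+1}}$, with canonical isometric embeddings $F_{\delta_i}:Y^{\delta_i}\to Y$. If $y\in Y^{\delta_i}$ and $0<\epsilon<\delta_i-\delta_{i+1}$, then there exist a subsequence $M_{j_k}^{\delta_i}$ containing points $y_{j_k}$ and numbers $\epsilon_{j_k}\to\epsilon$ such that $$B(y_{j_k},\epsilon_{j_k})=\{x\in M_{j_k}: d_{M_{j_k}}(x,y_{j_k})<\epsilon_{j_k}\}\subset M_{j_k}^{\delta_{i+1}}$$ and $$d_{GH}\Big(\big(\bar B(y_{j_k},\epsilon_{j_k}),d_{M_{j_k}}\big),\ \big(\bar B(F_{\delta_i}(y),\epsilon)\cap F_{\delta_{i+1}}(Y^{\delta_{i+1}}),d_Y\big)\Big)\to0,$$ where $\bar B$ denotes closed balls.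
   Context: For an open (not necessarily complete) Riemannian manifold $(M,g)$, $d_M$ is the length metric, $\bar M$ the metric completion, $\partial M:=\bar M\setminus M$ (no regularity assumed), $M^\delta=\{x\in M:d_M(x,\partial M)>\delta\}$ ($M^\delta=M$ if $\partial M=\emptyset$), and $\bar M^\delta$ is the metric completion of $M^\delta$ with the restricted metric $d_M$. Isometric embeddings are distance-preserving maps; $d_{GH}$ is the Gromov-Hausdorff distance (taken between metric completions if needed). Glued limit spaces of a sequence of open Riemannian manifolds $M_j$. Let $\delta_0\ge\delta_1\ge\cdots$ be positive numbers decreasing to $0$ such that for every $i$, $(\bar M_j^{\delta_i},d_{M_j})$ converges as $j\to\infty$ in the Gromov-Hausdorff sense to a compact metric space $Y^{\delta_i}$ (possibly empty). A subsequential limit isometric embedding $\varphi_{\delta_{i+1},\delta_i}:Y^{\delta_i}\to Y^{\delta_{i+1}}$ is one arising as follows: there are a compact metric space $Z_i$, isometric embeddings $\varphi_j:\bar M_j^{\delta_{i+1}}\to Z_i$, $\varphi_\infty:Y^{\delta_{i+1}}\to Z_i$ with $\varphi_j(\bar M_j^{\delta_{i+1}})\to\varphi_\infty(Y^{\delta_{i+1}})$ in the Hausdorff sense, and a subsequence with $\varphi_{j_k}(\bar M_{j_k}^{\delta_i})\to\varphi_\infty(\varphi_{\delta_{i+1},\delta_i}(Y^{\delta_i}))$ in the Hausdorff sense; it is the identity if $\delta_{i+1}=\delta_i$. Given such a map for each $i$, let $\varphi_{\delta_a,\delta_b}:Y^{\delta_b}\to Y^{\delta_a}$ ($a\ge b$)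 be the compositions ($\varphi_{\delta_a,\delta_a}=\mathrm{id}$), and let $Y=Y^{\delta_0}\sqcup\bigsqcup_{i=0}^\infty(Y^{\delta_{i+1}}\setminus\varphi_{\delta_{i+1},\delta_i}(Y^{\delta_i}))$. If $x\in Y$ lies in the piece contained in $Y^{\delta_a}$ and $y\in Y$ in the piece contained in $Y^{\delta_b}$ with $a\ge b$, then $d_Y(x,y)=d_Y(y,x)=d_{Y^{\delta_a}}(x,\varphi_{\delta_a,\delta_b}(y))$. Any such $(Y,d_Y)$ is a glued limit space of $\{M_j\}$. The canonical isometric embeddings $F_{\delta_i}:Y^{\delta_i}\to Y$ are: $F_{\delta_0}$ is the inclusion, and $F_{\delta_{i+1}}(y)=y$ if $y\notin\varphi_{\delta_{i+1},\delta_i}(Y^{\delta_i})$, $F_{\delta_{i+1}}(\varphi_{\delta_{i+1},\delta_i}(z))=F_{\delta_i}(z)$ for $z\in Y^{\delta_i}$. *)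

theory Defs
  imports "HOL-Analysis.Analysis"
begin

section \<open>Metric completions and inner regions\<close>

definition cauchy_rel :: "'a metric \<Rightarrow> ((nat \<Rightarrow> 'a) \<times> (nat \<Rightarrow> 'a)) set" where
  "cauchy_rel m = {(s, t). Metric_space.MCauchy (mspace m) (mdist m) s \<and>
     Metric_space.MCauchy (mspace m) (mdist m) t \<and> (\<lambda>n. mdist m (s n) (t n)) \<longlonglongrightarrow> 0}"

definition completion_carrier :: "'a metric \<Rightarrow> (nat \<Rightarrow> 'a) set set" where
  "completion_carrier m =
     {s. Metric_space.MCauchy (mspace m) (mdist m) s} // cauchy_rel m"

definition completion_dist :: "'a metric \<Rightarrow> (nat \<Rightarrow> 'a) set \<Rightarrow> (nat \<Rightarrow> 'a) set \<Rightarrow> real" where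
  "completion_dist m A B =
     (if A \<in> completion_carrier m \<and> B \<in> completion_carrier m
      then lim (\<lambda>n. mdist m ((SOME s. s \<in> A) n) ((SOME t. t \<in> B) n)) else 0)"

lemma equiv_cauchy_rel:
  "equiv {s. Metric_space.MCauchy (mspace m) (mdist m) s} (cauchy_rel m)"
proof -
  interpret Metric_space "mspace m" "mdist m" by simp
  have tr: "(\<lambda>n. mdist m (s n) (u n)) \<longlonglongrightarrow> 0"
    if "MCauchy s" "MCauchy t" "MCauchy u"
      "(\<lambda>n. mdist m (s n) (t n)) \<longlonglongrightarrow> 0" "(\<lambda>n. mdist m (t n) (u n)) \<longlonglongrightarrow> 0" for s t u
  proof (rule tendsto_sandwich[of "\<lambda>_. 0"])
    have "range s \<subseteq> mspace m" "range t \<subseteq> mspace m" "range u \<subseteq> mspace m"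
      using that by (auto simp: MCauchy_def)
    then show "\<forall>\<^sub>F n in sequentially. mdist m (s n) (u n) \<le> mdist m (s n) (t n) + mdist m (t n) (u n)"
      by (auto intro!: always_eventually triangle)
    show "(\<lambda>n. mdist m (s n) (t n) + mdist m (t n) (u n)) \<longlonglongrightarrow> 0"
      using tendsto_add[OF that(4,5)] by simp
  qed auto
  show ?thesis
  proof (rule equivI)
    show "cauchy_rel m \<subseteq> {s. MCauchy s} \<times> {s. MCauchy s}"
      by (auto simp: cauchy_rel_def)
    show "refl_on {s. MCauchy s} (cauchy_rel m)"
    proof (rule refl_onI)
      fix s assume "s \<in> {s. MCauchy s}"
      then have c: "MCauchy s" by simp
      then have "s n \<in> mspace m" for n by (auto simp: MCauchy_def)
      then have "(\<lambda>n. mdist m (s n) (s n)) = (\<lambda>_. 0)" by auto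
      then show "(s, s) \<in> cauchy_rel m" using c by (simp add: cauchy_rel_def)
    qed
    show "sym (cauchy_rel m)"
      by (auto simp: sym_def cauchy_rel_def commute)
    show "trans (cauchy_rel m)"
      unfolding trans_def cauchy_rel_def using tr by blast
  qed
qed

lemma completion_dist_lim:
  assumes "A \<in> completion_carrier m" "B \<in> completion_carrier m" "s \<in> A" "t \<in> B"
  shows "(\<lambda>n. mdist m (s n) (t n)) \<longlonglongrightarrow> completion_dist m A B"
proof -
  interpret Metric_space "mspace m" "mdist m" by simp
  note eq = equiv_cauchy_rel[of m]
  let ?s = "SOME s. s \<in> A" and ?t = "SOME t. t \<in> B"
  have s': "?s \<in> A" and t': "?t \<in> B"
    using assms(3,4) by (metis someI)+
  have rs: "(?s, s) \<in> cauchy_rel m" and rt: "(?t, t) \<in> cauchy_rel m"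
    using in_quotient_imp_in_rel[OF eq assms(1)[unfolded completion_carrier_def]]
      in_quotient_imp_in_rel[OF eq assms(2)[unfolded completion_carrier_def]] assms(3,4) s' t' by auto
  then have ms: "MCauchy ?s" "MCauchy s" "MCauchy ?t" "MCauchy t"
    by (auto simp: cauchy_rel_def)
  then have r: "?s n \<in> mspace m" "s n \<in> mspace m" "?t n \<in> mspace m" "t n \<in> mspace m" for n
    by (auto simp: MCauchy_def)
  have quad: "\<bar>mdist m a b - mdist m c d\<bar> \<le> mdist m a c + mdist m b d"
    if "a \<in> mspace m" "b \<in> mspace m" "c \<in> mspace m" "d \<in> mspace m" for a b c d
  proof -
    have "mdist m a b \<le> mdist m a c + mdist m c b" "mdist m c b \<le> mdist m c d + mdist m d b"
      "mdist m c d \<le> mdist m c a + mdist m a d" "mdist m a d \<le> mdist m a b + mdist m b d"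
      using that triangle by auto
    then show ?thesis using commute[of c a] commute[of d b] by auto
  qed
  have "Cauchy (\<lambda>n. mdist m (?s n) (?t n))"
  proof (rule CauchyI)
    fix e :: real assume "0 < e"
    then obtain N1 N2 where N: "\<forall>n n'. N1 \<le> n \<longrightarrow> N1 \<le> n' \<longrightarrow> mdist m (?s n) (?s n') < e/2"
      "\<forall>n n'. N2 \<le> n \<longrightarrow> N2 \<le> n' \<longrightarrow> mdist m (?t n) (?t n') < e/2"
      using ms(1,3) unfolding MCauchy_def by (meson half_gt_zero)
    show "\<exists>K. \<forall>n\<ge>K. \<forall>k\<ge>K. norm (mdist m (?s n) (?t n) - mdist m (?s k) (?t k)) < e"
    proof (intro exI allI impI)
      fix n k assume nk: "max N1 N2 \<le> n" "max N1 N2 \<le> k"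
      then have "mdist m (?s n) (?s k) < e/2" "mdist m (?t n) (?t k) < e/2"
        using N by auto
      then show "norm (mdist m (?s n) (?t n) - mdist m (?s k) (?t k)) < e"
        using quad[OF r(1) r(3) r(1) r(3), of n n k k] by simp
    qed
  qed
  then have "convergent (\<lambda>n. mdist m (?s n) (?t n))"
    by (simp add: Cauchy_convergent_iff)
  then have L: "(\<lambda>n. mdist m (?s n) (?t n)) \<longlonglongrightarrow> completion_dist m A B"
    using assms(1,2) by (simp add: completion_dist_def convergent_LIMSEQ_iff)
  have "(\<lambda>n. mdist m (s n) (t n) - mdist m (?s n) (?t n)) \<longlonglongrightarrow> 0"
  proof (rule tendsto_rabs_zero_cancel, rule tendsto_sandwich[of "\<lambda>_. 0"])
    show "\<forall>\<^sub>F n in sequentially. \<bar>mdist m (s n) (t n) - mdist m (?s n) (?t n)\<bar>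
            \<le> mdist m (?s n) (s n) + mdist m (?t n) (t n)"
      using quad[OF r(2) r(4) r(1) r(3)] by (auto simp: commute)
    show "(\<lambda>n. mdist m (?s n) (s n) + mdist m (?t n) (t n)) \<longlonglongrightarrow> 0"
      using rs rt tendsto_add[of "\<lambda>n. mdist m (?s n) (s n)" 0 _ "\<lambda>n. mdist m (?t n) (t n)" 0]
      by (auto simp: cauchy_rel_def)
  qed auto
  from tendsto_add[OF this L] show ?thesis by simp
qed

lemma Metric_space_completion: "Metric_space (completion_carrier m) (completion_dist m)"
proof -
  note eq = equiv_cauchy_rel[of m]
  have ne: "\<exists>s. s \<in> A" if "A \<in> completion_carrier m" for A
    using that in_quotient_imp_non_empty[OF eq] unfolding completion_carrier_def by blast
  have cau: "s n \<in> mspace m" if "A \<in> completion_carrier m" "s \<in> A" for A s n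
    using in_quotient_imp_subset[OF eq that(1)[unfolded completion_carrier_def]] that(2)
      Metric_space.MCauchy_def[OF Metric_space_mspace_mdist, of m s] by blast
  have nn: "0 \<le> completion_dist m A B" for A B
  proof (cases "A \<in> completion_carrier m \<and> B \<in> completion_carrier m")
    case True
    then obtain s t where "s \<in> A" "t \<in> B" using ne by blast
    with True show ?thesis
      by (intro LIMSEQ_le_const[OF completion_dist_lim[of A m B s t]]) auto
  qed (auto simp: completion_dist_def)
  have cm: "completion_dist m A B = completion_dist m B A" for A B
    by (simp add: completion_dist_def mdist_commute)
  have zr: "completion_dist m A B = 0 \<longleftrightarrow> A = B"
    if A: "A \<in> completion_carrier m" and B: "B \<in> completion_carrier m" for A B
  proof -
    obtain s t where st: "s \<in> A" "t \<in> B" using ne A B by blast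
    have "A = B \<longleftrightarrow> (s, t) \<in> cauchy_rel m"
      using quotient_eq_iff[OF eq] A B st unfolding completion_carrier_def by blast
    also have "\<dots> \<longleftrightarrow> (\<lambda>n. mdist m (s n) (t n)) \<longlonglongrightarrow> 0"
      using in_quotient_imp_subset[OF eq A[unfolded completion_carrier_def]]
        in_quotient_imp_subset[OF eq B[unfolded completion_carrier_def]] st
      by (auto simp: cauchy_rel_def)
    also have "\<dots> \<longleftrightarrow> completion_dist m A B = 0"
      using completion_dist_lim[OF A B st] LIMSEQ_unique by metis
    finally show ?thesis by simp
  qed
  have tr: "completion_dist m A C \<le> completion_dist m A B + completion_dist m B C"
    if A: "A \<in> completion_carrier m" and B: "B \<in> completion_carrier m"
      and C: "C \<in> completion_carrier m" for A B C
  proof -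
    obtain s t u where st: "s \<in> A" "t \<in> B" "u \<in> C" using ne A B C by metis
    show ?thesis
      using completion_dist_lim[OF A C st(1,3)]
        tendsto_add[OF completion_dist_lim[OF A B st(1,2)] completion_dist_lim[OF B C st(2,3)]]
      by (rule LIMSEQ_le) (meson A B C cau st mdist_triangle)
  qed
  show ?thesis
    by (rule Metric_space.intro) (use nn cm zr tr in auto)
qed

definition mcompletion :: "'a metric \<Rightarrow> (nat \<Rightarrow> 'a) set metric" where
  "mcompletion m = metric (completion_carrier m, completion_dist m)"

definition to_completion :: "'a metric \<Rightarrow> 'a \<Rightarrow> (nat \<Rightarrow> 'a) set" where
  "to_completion m x = cauchy_rel m `` {\<lambda>_. x}"

text \<open>If \<open>m\<close> is a subspace of \<open>m'\<close>, this is the canonical map from the completion of \<open>m\<close>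
  to the completion of \<open>m'\<close>: it sends a class of Cauchy sequences to the class in \<open>m'\<close>
  that contains it.\<close>

definition completion_incl :: "'a metric \<Rightarrow> (nat \<Rightarrow> 'a) set \<Rightarrow> (nat \<Rightarrow> 'a) set" where
  "completion_incl m' A = cauchy_rel m' `` A"

definition mboundary :: "'a metric \<Rightarrow> (nat \<Rightarrow> 'a) set set" where
  "mboundary m = mspace (mcompletion m) - to_completion m ` mspace m"

definition inner_region :: "'a metric \<Rightarrow> real \<Rightarrow> 'a set" where
  "inner_region m \<delta> = {x \<in> mspace m. mboundary m = {} \<or>
     (INF b\<in>mboundary m. mdist (mcompletion m) (to_completion m x) b) > \<delta>}"

definition inner_completion :: "'a metric \<Rightarrow> real \<Rightarrow> (nat \<Rightarrow> 'a) set metric" where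
  "inner_completion m \<delta> = mcompletion (submetric m (inner_region m \<delta>))"


section \<open>Hausdorff and Gromov-Hausdorff distance\<close>

text \<open>Both distances take values in \<open>[0, \<infinity>]\<close>: the empty space is at distance \<open>\<infinity>\<close> from
  every nonempty space and at distance \<open>0\<close> from itself.\<close>

definition hausdorff_dist :: "'a metric \<Rightarrow> 'a set \<Rightarrow> 'a set \<Rightarrow> ennreal" where
  "hausdorff_dist Z A B =
     (INF r\<in>{r::real. 0 < r \<and> (\<forall>a\<in>A. \<exists>b\<in>B. mdist Z a b < r) \<and> (\<forall>b\<in>B. \<exists>a\<in>A. mdist Z a b < r)}.
        ennreal r)"

definition isometric_embedding :: "'a metric \<Rightarrow> 'b metric \<Rightarrow> ('a \<Rightarrow> 'b) \<Rightarrow> bool" where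
  "isometric_embedding X Z f \<longleftrightarrow> f ` mspace X \<subseteq> mspace Z \<and>
     (\<forall>x\<in>mspace X. \<forall>y\<in>mspace X. mdist Z (f x) (f y) = mdist X x y)"

text \<open>The infimum is over all metric spaces \<open>Z\<close> whose points are of type \<open>'a + 'b\<close>. This is no
  restriction: in an arbitrary \<open>Z\<close> only the union of the two images matters, and it injects
  into \<open>'a + 'b\<close> (lemma \<open>gh_dist_le\<close>).\<close>

definition gh_dist :: "'a metric \<Rightarrow> 'b metric \<Rightarrow> ennreal" where
  "gh_dist X Y =
     (INF (Z, f, g)\<in>{(Z :: ('a + 'b) metric, f, g).
          isometric_embedding X Z f \<and> isometric_embedding Y Z g}.
        hausdorff_dist Z (f ` mspace X) (g ` mspace Y))"

lemma gh_dist_le: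
  fixes X :: "'a metric" and Y :: "'b metric" and Z :: "'z metric"
  assumes f: "isometric_embedding X Z f" and g: "isometric_embedding Y Z g"
  shows "gh_dist X Y \<le> hausdorff_dist Z (f ` mspace X) (g ` mspace Y)"
proof -
  define h :: "'z \<Rightarrow> 'a + 'b" where
    "h z = (if z \<in> f ` mspace X then Inl (inv_into (mspace X) f z)
            else Inr (inv_into (mspace Y) g z))" for z
  define k :: "'a + 'b \<Rightarrow> 'z" where "k = case_sum f g"
  define W where "W = f ` mspace X \<union> g ` mspace Y"
  define Z' where "Z' = metric (h ` W, \<lambda>u v. mdist Z (k u) (k v))"
  have kh: "k (h z) = z" if "z \<in> W" for z
    using that unfolding W_def h_def k_def by (auto simp: f_inv_into_f)
  have WZ: "W \<subseteq> mspace Z"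
    using f g by (auto simp: W_def isometric_embedding_def)
  have M: "Metric_space (h ` W) (\<lambda>u v. mdist Z (k u) (k v))"
  proof (rule Metric_space.intro)
    show "mdist Z (k u) (k v) = mdist Z (k v) (k u)" for u v
      by (rule mdist_commute)
    show "mdist Z (k u) (k v) = 0 \<longleftrightarrow> u = v" if "u \<in> h ` W" "v \<in> h ` W" for u v
      using that kh WZ by (auto simp: subset_iff)
    show "mdist Z (k u) (k w) \<le> mdist Z (k u) (k v) + mdist Z (k v) (k w)"
      if "u \<in> h ` W" "v \<in> h ` W" "w \<in> h ` W" for u v w
      using that kh WZ by (auto simp: subset_iff intro!: mdist_triangle)
  qed simp
  have Z': "mspace Z' = h ` W" "mdist Z' = (\<lambda>u v. mdist Z (k u) (k v))"
    unfolding Z'_def using Metric_space.mspace_metric[OF M] Metric_space.mdist_metric[OF M] by auto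
  have emb: "isometric_embedding X Z' (h \<circ> f)" "isometric_embedding Y Z' (h \<circ> g)"
    using f g kh unfolding isometric_embedding_def Z' by (auto simp: W_def)
  have "hausdorff_dist Z' ((h \<circ> f) ` mspace X) ((h \<circ> g) ` mspace Y) =
        hausdorff_dist Z (f ` mspace X) (g ` mspace Y)"
    unfolding hausdorff_dist_def Z' using kh by (simp add: W_def)
  moreover have "gh_dist X Y \<le> hausdorff_dist Z' ((h \<circ> f) ` mspace X) ((h \<circ> g) ` mspace Y)"
    unfolding gh_dist_def by (rule INF_lower2[of "(Z', h \<circ> f, h \<circ> g)"]) (use emb in auto)
  ultimately show ?thesis by simp
qed


section \<open>Riemannian manifolds\<close>

definition partial_deriv :: "nat \<Rightarrow> ((nat \<Rightarrow> real) \<Rightarrow> real) \<Rightarrow> (nat \<Rightarrow> real) \<Rightarrow> real" where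
  "partial_deriv i f x = deriv (\<lambda>t. f (x(i := t))) (x i)"

text \<open>Differentiability on a set \<open>U\<close> that is open in the \<open>n\<close>-dimensional \<open>Euclidean_space n\<close>,
  whose points are the sequences vanishing from index \<open>n\<close> on.\<close>

primrec Ck_on :: "nat \<Rightarrow> nat \<Rightarrow> (nat \<Rightarrow> real) set \<Rightarrow> ((nat \<Rightarrow> real) \<Rightarrow> real) \<Rightarrow> bool" where
  "Ck_on n 0 U f \<longleftrightarrow> continuous_map (subtopology (Euclidean_space n) U) euclideanreal f"
| "Ck_on n (Suc k) U f \<longleftrightarrow>
     continuous_map (subtopology (Euclidean_space n) U) euclideanreal f \<and>
     (\<forall>i<n. (\<forall>x\<in>U. (\<lambda>t. f (x(i := t))) field_differentiable (at (x i))) \<and>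
            Ck_on n k U (partial_deriv i f))"

definition smooth_on :: "nat \<Rightarrow> (nat \<Rightarrow> real) set \<Rightarrow> ((nat \<Rightarrow> real) \<Rightarrow> real) \<Rightarrow> bool" where
  "smooth_on n U f \<longleftrightarrow> (\<forall>k. Ck_on n k U f)"

type_synonym 'a chart = "'a set \<times> ('a \<Rightarrow> nat \<Rightarrow> real)"

text \<open>\<open>gcomp M c p i j\<close> is the component \<open>g\<^sub>i\<^sub>j\<close> of the metric tensor at \<open>p\<close> in the chart \<open>c\<close>.\<close>

record 'a riemannian =
  mtop :: "'a topology"
  mdim :: nat
  atlas :: "'a chart set"
  gcomp :: "'a chart \<Rightarrow> 'a \<Rightarrow> nat \<Rightarrow> nat \<Rightarrow> real"

definition smooth_manifold :: "('a, 'b) riemannian_scheme \<Rightarrow> bool" where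
  "smooth_manifold M \<longleftrightarrow>
     Hausdorff_space (mtop M) \<and> second_countable (mtop M) \<and>
     (\<Union>(U, \<phi>)\<in>atlas M. U) = topspace (mtop M) \<and>
     (\<forall>(U, \<phi>)\<in>atlas M. openin (mtop M) U \<and> openin (Euclidean_space (mdim M)) (\<phi> ` U) \<and>
        homeomorphic_map (subtopology (mtop M) U)
          (subtopology (Euclidean_space (mdim M)) (\<phi> ` U)) \<phi>) \<and>
     (\<forall>(U, \<phi>)\<in>atlas M. \<forall>(V, \<psi>)\<in>atlas M. \<forall>k<mdim M.
        smooth_on (mdim M) (\<phi> ` (U \<inter> V)) (\<lambda>x. \<psi> (inv_into U \<phi> x) k))"

definition riemannian_metric :: "('a, 'b) riemannian_scheme \<Rightarrow> bool" where
  "riemannian_metric M \<longleftrightarrow>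
     (\<forall>(U, \<phi>)\<in>atlas M. \<forall>i<mdim M. \<forall>j<mdim M.
        smooth_on (mdim M) (\<phi> ` U) (\<lambda>x. gcomp M (U, \<phi>) (inv_into U \<phi> x) i j)) \<and>
     (\<forall>(U, \<phi>)\<in>atlas M. \<forall>p\<in>U.
        (\<forall>i<mdim M. \<forall>j<mdim M. gcomp M (U, \<phi>) p i j = gcomp M (U, \<phi>) p j i) \<and>
        (\<forall>v. (\<exists>i<mdim M. v i \<noteq> 0) \<longrightarrow>
           0 < (\<Sum>i<mdim M. \<Sum>j<mdim M. gcomp M (U, \<phi>) p i j * v i * v j))) \<and>
     (\<forall>(U, \<phi>)\<in>atlas M. \<forall>(V, \<psi>)\<in>atlas M. \<forall>p\<in>U \<inter> V. \<forall>i<mdim M. \<forall>j<mdim M.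
        gcomp M (U, \<phi>) p i j =
          (\<Sum>k<mdim M. \<Sum>l<mdim M. gcomp M (V, \<psi>) p k l *
             partial_deriv i (\<lambda>x. \<psi> (inv_into U \<phi> x) k) (\<phi> p) *
             partial_deriv j (\<lambda>x. \<psi> (inv_into U \<phi> x) l) (\<phi> p)))"

text \<open>Manifolds are connected, so that the length metric is finite. They have no manifold
  boundary and need not be complete.\<close>

definition open_riemannian_manifold :: "('a, 'b) riemannian_scheme \<Rightarrow> bool" where
  "open_riemannian_manifold M \<longleftrightarrow>
     smooth_manifold M \<and> connected_space (mtop M) \<and> riemannian_metric M"

definition C1_closed_interval :: "real \<Rightarrow> real \<Rightarrow> (real \<Rightarrow> real) \<Rightarrow> bool" where
  "C1_closed_interval a b f \<longleftrightarrow> (\<exists>f'. continuous_on {a..b} f' \<and>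
     (\<forall>t\<in>{a..b}. (f has_real_derivative f' t) (at t within {a..b})))"

text \<open>The library notion \<open>piecewise_C1_differentiable_on\<close> is not used because it allows
  derivatives that are unbounded near a break point, hence curves of infinite length.\<close>

definition piecewise_C1_curve :: "('a, 'b) riemannian_scheme \<Rightarrow> (real \<Rightarrow> 'a) \<Rightarrow> bool" where
  "piecewise_C1_curve M \<gamma> \<longleftrightarrow> pathin (mtop M) \<gamma> \<and>
     (\<exists>S. finite S \<and>
        (\<forall>a b. 0 \<le> a \<and> a < b \<and> b \<le> 1 \<and> {a<..<b} \<inter> S = {} \<longrightarrow>
           (\<forall>(U, \<phi>)\<in>atlas M. \<gamma> ` {a..b} \<subseteq> U \<longrightarrow>
              (\<forall>i<mdim M. C1_closed_interval a b (\<lambda>t. \<phi> (\<gamma> t) i)))))"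

definition curve_speed :: "('a, 'b) riemannian_scheme \<Rightarrow> (real \<Rightarrow> 'a) \<Rightarrow> real \<Rightarrow> real" where
  "curve_speed M \<gamma> t =
     (let c = (SOME c. c \<in> atlas M \<and> \<gamma> t \<in> fst c); v = (\<lambda>i. deriv (\<lambda>s. snd c (\<gamma> s) i) t)
      in sqrt (\<Sum>i<mdim M. \<Sum>j<mdim M. gcomp M c (\<gamma> t) i j * v i * v j))"

definition curve_length :: "('a, 'b) riemannian_scheme \<Rightarrow> (real \<Rightarrow> 'a) \<Rightarrow> real" where
  "curve_length M \<gamma> = integral {0..1} (curve_speed M \<gamma>)"

definition riemannian_dist :: "('a, 'b) riemannian_scheme \<Rightarrow> 'a \<Rightarrow> 'a \<Rightarrow> real" where
  "riemannian_dist M p q =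
     (if p \<in> topspace (mtop M) \<and> q \<in> topspace (mtop M)
      then INF \<gamma>\<in>{\<gamma>. piecewise_C1_curve M \<gamma> \<and> \<gamma> 0 = p \<and> \<gamma> 1 = q}. curve_length M \<gamma> else 0)"

text \<open>By the classical theorem that the infimum of lengths is a genuine metric on a connected
  Riemannian manifold, \<open>mspace\<close> and \<open>mdist\<close> of the following are \<open>topspace (mtop M)\<close> and
  \<open>riemannian_dist M\<close> if \<open>open_riemannian_manifold M\<close>; elsewhere it is a junk value.\<close>

definition length_metric :: "('a, 'b) riemannian_scheme \<Rightarrow> 'a metric" where
  "length_metric M = metric (topspace (mtop M), riemannian_dist M)"


section \<open>Glued limit spaces\<close>

text \<open>\<open>\<phi>\<close> is a subsequential limit isometric embedding of \<open>Y \<delta>\<close> into \<open>Y \<delta>'\<close>, where \<open>\<delta>' \<le> \<delta>\<close>.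
  The type argument is the type of the points of the ambient compact space \<open>Z\<close>.\<close>

definition subsequential_limit_embedding ::
  "'z itself \<Rightarrow> (nat \<Rightarrow> 'a metric) \<Rightarrow> (real \<Rightarrow> 'y metric) \<Rightarrow> real \<Rightarrow> real \<Rightarrow> ('y \<Rightarrow> 'y) \<Rightarrow> bool" where
  "subsequential_limit_embedding _ m Y \<delta>' \<delta> \<phi> \<longleftrightarrow>
     isometric_embedding (Y \<delta>) (Y \<delta>') \<phi> \<and>
     (if \<delta>' = \<delta> then \<forall>y\<in>mspace (Y \<delta>). \<phi> y = y
      else \<exists>(Z :: 'z metric) \<psi> \<psi>' r.
        compact_space (mtopology_of Z) \<and>
        (\<forall>j. isometric_embedding (inner_completion (m j) \<delta>') Z (\<psi> j)) \<and>
        isometric_embedding (Y \<delta>') Z \<psi>' \<and>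
        (\<lambda>j. hausdorff_dist Z (\<psi> j ` mspace (inner_completion (m j) \<delta>'))
                (\<psi>' ` mspace (Y \<delta>'))) \<longlonglongrightarrow> 0 \<and>
        strict_mono (r :: nat \<Rightarrow> nat) \<and>
        (\<lambda>k. hausdorff_dist Z
                (\<psi> (r k) ` completion_incl (submetric (m (r k)) (inner_region (m (r k)) \<delta>'))
                   ` mspace (inner_completion (m (r k)) \<delta>))
                (\<psi>' ` \<phi> ` mspace (Y \<delta>))) \<longlonglongrightarrow> 0)"

text \<open>\<open>connecting \<phi> a b\<close> is \<open>\<phi> (a - 1) \<circ> \<dots> \<circ> \<phi> b\<close>, from the \<open>b\<close>-th to the \<open>a\<close>-th space; it is
  only meaningful for \<open>b \<le> a\<close>.\<close>

primrec connecting :: "(nat \<Rightarrow> 'y \<Rightarrow> 'y) \<Rightarrow> nat \<Rightarrow> nat \<Rightarrow> 'y \<Rightarrow> 'y" where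
  "connecting \<phi> 0 b = id"
| "connecting \<phi> (Suc a) b = (if Suc a \<le> b then id else \<phi> a \<circ> connecting \<phi> a b)"

text \<open>Points of the disjoint union are tagged by the index of the piece that contains them.
  Here \<open>Y i\<close> is the \<open>i\<close>-th space and \<open>\<phi> i\<close> maps \<open>Y i\<close> to \<open>Y (Suc i)\<close>.\<close>

definition glued_carrier :: "(nat \<Rightarrow> 'y metric) \<Rightarrow> (nat \<Rightarrow> 'y \<Rightarrow> 'y) \<Rightarrow> (nat \<times> 'y) set" where
  "glued_carrier Y \<phi> =
     {0} \<times> mspace (Y 0) \<union> (\<Union>i. {Suc i} \<times> (mspace (Y (Suc i)) - \<phi> i ` mspace (Y i)))"

definition glued_dist ::
  "(nat \<Rightarrow> 'y metric) \<Rightarrow> (nat \<Rightarrow> 'y \<Rightarrow> 'y) \<Rightarrow> nat \<times> 'y \<Rightarrow> nat \<times> 'y \<Rightarrow> real" where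
  "glued_dist Y \<phi> = (\<lambda>(a, x) (b, y).
     if b \<le> a then mdist (Y a) x (connecting \<phi> a b y)
     else mdist (Y b) y (connecting \<phi> b a x))"

lemma isometric_embedding_connecting:
  assumes "\<And>i. isometric_embedding (Y i) (Y (Suc i)) (\<phi> i)" and "b \<le> a"
  shows "isometric_embedding (Y b) (Y a) (connecting \<phi> a b)"
  using assms(2)
proof (induction a)
  case 0
  then show ?case by (simp add: isometric_embedding_def)
next
  case (Suc a)
  show ?case
  proof (cases "Suc a \<le> b")
    case True
    with Suc.prems have "b = Suc a" by simp
    then show ?thesis by (simp add: isometric_embedding_def)
  next
    case False
    with Suc assms(1)[of a] show ?thesis
      by (auto simp: isometric_embedding_def image_subset_iff)
  qed
qed

lemma connecting_trans:
  "c \<le> b \<Longrightarrow> b \<le> a \<Longrightarrow> connecting \<phi> a b (connecting \<phi> b c x) = connecting \<phi> a c x"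
proof (induction a)
  case (Suc a)
  then show ?case by (cases "b = Suc a") auto
qed simp

lemma connecting_self [simp]: "connecting \<phi> a a = id"
  by (cases a) auto

lemma Metric_space_glued:
  assumes iso: "\<And>i. isometric_embedding (Y i) (Y (Suc i)) (\<phi> i)"
  shows "Metric_space (glued_carrier Y \<phi>) (glued_dist Y \<phi>)"
proof -
  note ic = isometric_embedding_connecting[of Y \<phi>, OF iso]
  have ms: "x \<in> mspace (Y a)" if "(a, x) \<in> glued_carrier Y \<phi>" for a x
    using that by (auto simp: glued_carrier_def)
  have cin: "connecting \<phi> n a x \<in> mspace (Y n)" if "(a, x) \<in> glued_carrier Y \<phi>" "a \<le> n" for a x n
    using ic[OF that(2)] ms[OF that(1)] by (auto simp: isometric_embedding_def)
  have up: "glued_dist Y \<phi> (a, x) (b, y) =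
      mdist (Y n) (connecting \<phi> n a x) (connecting \<phi> n b y)"
    if c: "(a, x) \<in> glued_carrier Y \<phi>" "(b, y) \<in> glued_carrier Y \<phi>" and n: "a \<le> n" "b \<le> n"
    for a b x y n
  proof (cases "b \<le> a")
    case True
    have "mdist (Y n) (connecting \<phi> n a x) (connecting \<phi> n a (connecting \<phi> a b y)) =
          mdist (Y a) x (connecting \<phi> a b y)"
      using ic[OF n(1)] ms[OF c(1)] cin[OF c(2) True] by (auto simp: isometric_embedding_def)
    then show ?thesis using True n by (simp add: glued_dist_def connecting_trans)
  next
    case False
    then have ab: "a \<le> b" by simp
    have "mdist (Y n) (connecting \<phi> n b y) (connecting \<phi> n b (connecting \<phi> b a x)) =
          mdist (Y b) y (connecting \<phi> b a x)"
      using ic[OF n(2)] ms[OF c(2)] cin[OF c(1) ab] by (auto simp: isometric_embedding_def)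
    then show ?thesis using False ab n by (simp add: glued_dist_def connecting_trans mdist_commute)
  qed
  have notin: "x \<noteq> connecting \<phi> a b y" if c: "(a, x) \<in> glued_carrier Y \<phi>" "(b, y) \<in> glued_carrier Y \<phi>" and lt: "b < a"
    for a b x y
  proof -
    obtain a' where a': "a = Suc a'" using lt by (cases a) auto
    have "connecting \<phi> a b y = \<phi> a' (connecting \<phi> a' b y)" using lt a' by simp
    moreover have "connecting \<phi> a' b y \<in> mspace (Y a')" using cin[OF c(2)] lt a' by simp
    moreover have "x \<notin> \<phi> a' ` mspace (Y a')" using c(1) a' by (auto simp: glued_carrier_def)
    ultimately show ?thesis by auto
  qed
  show ?thesis
  proof (rule Metric_space.intro)
    show "0 \<le> glued_dist Y \<phi> p q" for p q
      by (auto simp: glued_dist_def split: prod.split)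
    show "glued_dist Y \<phi> p q = glued_dist Y \<phi> q p" for p q
      by (auto simp: glued_dist_def mdist_commute split: prod.split)
  next
    fix p q assume pq: "p \<in> glued_carrier Y \<phi>" "q \<in> glued_carrier Y \<phi>"
    obtain a x b y where ab: "p = (a, x)" "q = (b, y)" by (metis prod.exhaust)
    note c = pq[unfolded ab]
    consider "b < a" | "a < b" | "a = b" by linarith
    then show "glued_dist Y \<phi> p q = 0 \<longleftrightarrow> p = q"
    proof cases
      case 1
      then show ?thesis
        using notin[OF c 1] ms[OF c(1)] cin[OF c(2), of a] by (simp add: ab glued_dist_def)
    next
      case 2
      then show ?thesis
        using notin[OF c(2,1) 2] ms[OF c(2)] cin[OF c(1), of b] by (auto simp: ab glued_dist_def)
    next
      case 3
      then show ?thesis using ms[OF c(1)] ms[OF c(2)] by (auto simp: ab glued_dist_def)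
    qed
  next
    fix p q s assume pqs: "p \<in> glued_carrier Y \<phi>" "q \<in> glued_carrier Y \<phi>" "s \<in> glued_carrier Y \<phi>"
    obtain a x b y c z where ab: "p = (a, x)" "q = (b, y)" "s = (c, z)" by (metis prod.exhaust)
    let ?n = "max a (max b c)"
    show "glued_dist Y \<phi> p s \<le> glued_dist Y \<phi> p q + glued_dist Y \<phi> q s"
      using pqs up[of a x b y ?n] up[of a x c z ?n] up[of b y c z ?n] cin[of a x ?n] cin[of b y ?n]
        cin[of c z ?n] by (auto simp: ab intro!: mdist_triangle)
  qed
qed

definition glued_space :: "(nat \<Rightarrow> 'y metric) \<Rightarrow> (nat \<Rightarrow> 'y \<Rightarrow> 'y) \<Rightarrow> (nat \<times> 'y) metric" where
  "glued_space Y \<phi> = metric (glued_carrier Y \<phi>, glued_dist Y \<phi>)"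

primrec canonical_embedding ::
  "(nat \<Rightarrow> 'y metric) \<Rightarrow> (nat \<Rightarrow> 'y \<Rightarrow> 'y) \<Rightarrow> nat \<Rightarrow> 'y \<Rightarrow> nat \<times> 'y" where
  "canonical_embedding Y \<phi> 0 y = (0, y)"
| "canonical_embedding Y \<phi> (Suc i) y =
     (if y \<in> \<phi> i ` mspace (Y i)
      then canonical_embedding Y \<phi> i (inv_into (mspace (Y i)) (\<phi> i) y) else (Suc i, y))"

end

theory Submission
  imports Defs
begin

text \<open>
  The argument takes place entirely in the metric spaces. The distance to the boundary is
  1-Lipschitz, so a closed ball of radius at most \<open>\<delta> i - \<delta> (Suc i)\<close> about a point at boundary
  distance more than \<open>\<delta> i\<close> stays in the inner region of depth \<open>\<delta> (Suc i)\<close>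
  (lemma \<open>mcball_subset_inner_region\<close>). It can therefore be seen in the compact space \<open>Z\<close> that
  witnesses the subsequential limit embedding \<open>\<phi> i\<close>. In \<open>Z\<close> the inner regions of depth
  \<open>\<delta> (Suc i)\<close> converge to a copy of \<open>Y (\<delta> (Suc i))\<close>, and along a subsequence those of depth
  \<open>\<delta> i\<close> converge to the copy of \<open>\<phi> i ` Y (\<delta> i)\<close>. The latter provides centres in the inner
  regions of depth \<open>\<delta> i\<close> that converge to \<open>\<phi> i y\<close>, and the canonical embedding of
  \<open>Y (\<delta> (Suc i))\<close> into the glued space sends \<open>\<phi> i y\<close> to the prescribed centre.

  Closed balls of a fixed radius \<open>\<epsilon>\<close> need not converge when the ambient sets do: a point of the
  limit at distance exactly \<open>\<epsilon>\<close> from the centre may be approximated only by points slightly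
  farther away. Enlarging the radii to \<open>\<epsilon> + 2 * \<eta> k\<close>, where \<open>\<eta> k\<close> bounds all approximation
  errors at stage \<open>k\<close>, captures these points. No unwanted limit points appear, since in a compact
  space the closed ball of radius \<open>\<epsilon> + \<tau>\<close> lies in any prescribed uniform neighbourhood of the
  closed ball of radius \<open>\<epsilon>\<close> once \<open>\<tau>\<close> is small (lemmas \<open>mcball_near_smaller_mcball\<close> and
  \<open>gh_dist_mcballs_tendsto_0\<close>).
\<close>

section \<open>Hausdorff and Gromov-Hausdorff convergence\<close>

definition hausdorff_close :: "'a metric \<Rightarrow> 'a set \<Rightarrow> 'a set \<Rightarrow> real \<Rightarrow> bool" where
  "hausdorff_close Z A B r \<longleftrightarrow>
     (\<forall>a\<in>A. \<exists>b\<in>B. mdist Z a b < r) \<and> (\<forall>b\<in>B. \<exists>a\<in>A. mdist Z a b < r)"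

lemma hausdorff_close_mono: "hausdorff_close Z A B r \<Longrightarrow> r \<le> s \<Longrightarrow> hausdorff_close Z A B s"
  unfolding hausdorff_close_def by (meson less_le_trans)

lemma hausdorff_dist_le_if_close:
  "0 < r \<Longrightarrow> hausdorff_close Z A B r \<Longrightarrow> hausdorff_dist Z A B \<le> ennreal r"
  unfolding hausdorff_dist_def hausdorff_close_def by (rule INF_lower) auto

lemma eventually_hausdorff_close:
  assumes "((\<lambda>k. hausdorff_dist Z (A k) (B k)) \<longlongrightarrow> 0) net" and "0 < r"
  shows "\<forall>\<^sub>F k in net. hausdorff_close Z (A k) (B k) r"
proof -
  have "\<forall>\<^sub>F k in net. hausdorff_dist Z (A k) (B k) < ennreal r"
    using assms by (intro order_tendstoD) auto
  then show ?thesis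
  proof eventually_elim
    case (elim k)
    then obtain s where s: "hausdorff_close Z (A k) (B k) s" "ennreal s < ennreal r"
      unfolding hausdorff_dist_def hausdorff_close_def by (auto simp: INF_less_iff)
    from s(2) have "s \<le> r" by (metis ennreal_leI linorder_le_cases not_less)
    with s(1) show ?case by (rule hausdorff_close_mono)
  qed
qed

lemma gh_dist_le_if_close:
  assumes "isometric_embedding X Z f" and "isometric_embedding Y Z g" and "0 < r"
    and "hausdorff_close Z (f ` mspace X) (g ` mspace Y) r"
  shows "gh_dist X Y \<le> ennreal r"
  using gh_dist_le[OF assms(1,2)] hausdorff_dist_le_if_close[OF assms(3,4)] by (rule order_trans)

lemma isometric_embedding_compose:
  "isometric_embedding X Y f \<Longrightarrow> isometric_embedding Y Z g \<Longrightarrow> isometric_embedding X Z (g \<circ> f)"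
  by (auto simp: isometric_embedding_def image_subset_iff)

lemma isometric_embedding_submetric:
  "isometric_embedding X Z f \<Longrightarrow> isometric_embedding (submetric X S) Z f"
  by (auto simp: isometric_embedding_def)

lemma isometric_embedding_inj_on: "isometric_embedding X Y h \<Longrightarrow> inj_on h (mspace X)"
  by (rule inj_onI) (metis isometric_embedding_def mdist_zero image_subset_iff)

text \<open>This transports convergence of balls from \<open>Y (\<delta> (Suc i))\<close> to its image in the glued space:
  every embedding of \<open>Y\<close> also embeds \<open>Y'\<close>, with the same image, through the inverse of \<open>h\<close>.\<close>

lemma gh_dist_le_isometric_image:
  fixes X :: "'x metric" and Y :: "'y metric" and Y' :: "'w metric"
  assumes h: "isometric_embedding Y Y' h" and surj: "h ` mspace Y = mspace Y'"
  shows "gh_dist X Y' \<le> gh_dist X Y"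
proof -
  have "gh_dist X Y' \<le> hausdorff_dist Z (f ` mspace X) (g ` mspace Y)"
    if f: "isometric_embedding X Z f" and g: "isometric_embedding Y Z g"
    for Z :: "('x + 'y) metric" and f g
  proof -
    let ?h' = "inv_into (mspace Y) h"
    have inv: "?h' (h y) = y" if "y \<in> mspace Y" for y
      using that isometric_embedding_inj_on[OF h] by simp
    have "isometric_embedding Y' Y ?h'"
      using h inv unfolding isometric_embedding_def surj[symmetric] by auto
    then have "isometric_embedding Y' Z (g \<circ> ?h')"
      using g by (rule isometric_embedding_compose)
    then have "gh_dist X Y' \<le> hausdorff_dist Z (f ` mspace X) ((g \<circ> ?h') ` mspace Y')"
      by (rule gh_dist_le[OF f])
    also have "(g \<circ> ?h') ` mspace Y' = g ` mspace Y"
      unfolding surj[symmetric] image_image using inv by simp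
    finally show ?thesis .
  qed
  then show ?thesis unfolding gh_dist_def[of X Y] by (auto intro!: INF_greatest)
qed

section \<open>Convergence of closed balls\<close>

text \<open>Otherwise there would be points at distance at most \<open>\<epsilon> + 1 / (n + 1)\<close> from the centre, all
  at distance at least \<open>e\<close> from the closed \<open>\<epsilon>\<close>-ball, and a subsequential limit of them would lie
  in that ball.\<close>

lemma mcball_near_smaller_mcball:
  assumes cpt: "compact_space (mtopology_of W)" and q: "q \<in> mspace W" and e: "0 < e"
  shows "\<exists>\<tau>>0. \<forall>z\<in>mcball_of W q (\<epsilon> + \<tau>). \<exists>w\<in>mcball_of W q \<epsilon>. mdist W z w < e"
proof (rule ccontr)
  interpret Metric_space "mspace W" "mdist W" by simp
  assume neg: "\<not> ?thesis"
  have "\<exists>z\<in>mcball_of W q (\<epsilon> + inverse (real (Suc n))). \<forall>w\<in>mcball_of W q \<epsilon>. e \<le> mdist W z w" for n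
    using neg by (metis inverse_positive_iff_positive not_less of_nat_0_less_iff zero_less_Suc)
  then obtain z where z: "\<And>n. z n \<in> mcball_of W q (\<epsilon> + inverse (real (Suc n)))"
      "\<And>n w. w \<in> mcball_of W q \<epsilon> \<Longrightarrow> e \<le> mdist W (z n) w"
    by metis
  then have zW: "z n \<in> mspace W" for n by simp
  with cpt obtain l s where l: "l \<in> mspace W" "strict_mono (s :: nat \<Rightarrow> nat)"
      "limitin mtopology (z \<circ> s) l sequentially"
    unfolding mtopology_of_def compact_space_sequentially by blast
  then have lim: "(\<lambda>n. mdist W (z (s n)) l) \<longlonglongrightarrow> 0"
    by (simp add: limitin_metric_dist_null)
  have "(\<lambda>n. \<epsilon> + inverse (real (Suc (s n))) + mdist W (z (s n)) l) \<longlonglongrightarrow> \<epsilon> + 0 + 0"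
    using LIMSEQ_subseq_LIMSEQ[OF LIMSEQ_inverse_real_of_nat l(2)] lim
    by (intro tendsto_intros) (auto simp: o_def)
  moreover have "mdist W q l \<le> \<epsilon> + inverse (real (Suc (s n))) + mdist W (z (s n)) l" for n
    using triangle[OF q zW l(1), of "s n"] z(1)[of "s n"] by simp
  ultimately have "mdist W q l \<le> \<epsilon>"
    by (intro LIMSEQ_le_const) auto
  then have "e \<le> mdist W (z (s n)) l" for n
    using z(2) q l(1) by simp
  then have "e \<le> 0" by (intro LIMSEQ_le_const[OF lim]) auto
  with e show False by simp
qed

text \<open>The radius \<open>\<epsilon> + 2 * \<eta> k\<close> pays \<open>\<eta> k\<close> once for the displacement of the centre and once for
  that of the point, so every point of the limit ball has an approximating point in the \<open>k\<close>-th
  ball. Conversely a point of the \<open>k\<close>-th ball is close to a point of the limit ball of radius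
  \<open>\<epsilon> + 4 * \<eta> k\<close>, and compactness brings that point back into the ball of radius \<open>\<epsilon>\<close>.\<close>

lemma gh_dist_mcballs_tendsto_0:
  assumes cpt: "compact_space (mtopology_of W)"
    and f: "\<And>k. isometric_embedding (X k) Z (f k)" and g: "isometric_embedding W Z g"
    and p: "\<And>k. p k \<in> mspace (X k)" and q: "q \<in> mspace W"
    and \<eta>: "\<eta> \<longlonglongrightarrow> 0"
    and centre: "\<And>k. mdist Z (f k (p k)) (g q) < \<eta> k"
    and close: "\<And>k. hausdorff_close Z (f k ` mspace (X k)) (g ` mspace W) (\<eta> k)"
  shows "(\<lambda>k. gh_dist (submetric (X k) (mcball_of (X k) (p k) (\<epsilon> + 2 * \<eta> k)))
                 (submetric W (mcball_of W q \<epsilon>))) \<longlonglongrightarrow> 0"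
    (is "(\<lambda>k. gh_dist (submetric _ (?B k)) (submetric _ ?C)) \<longlonglongrightarrow> 0")
proof -
  have fZ: "f k x \<in> mspace Z" if "x \<in> mspace (X k)" for k x
    using f[of k] that by (auto simp: isometric_embedding_def)
  have gZ: "g w \<in> mspace Z" if "w \<in> mspace W" for w
    using g that by (auto simp: isometric_embedding_def)
  have ev: "\<forall>\<^sub>F k in sequentially. gh_dist (submetric (X k) (?B k)) (submetric W ?C) \<le> ennreal e"
    if e: "0 < e" for e
  proof -
    obtain \<tau> where \<tau>: "0 < \<tau>"
        "\<And>z. z \<in> mcball_of W q (\<epsilon> + \<tau>) \<Longrightarrow> \<exists>w\<in>?C. mdist W z w < e / 2"
      using mcball_near_smaller_mcball[OF cpt q half_gt_zero[OF e], of \<epsilon>] by auto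
    have "\<forall>\<^sub>F k in sequentially. \<eta> k < min (\<tau> / 4) (e / 2)"
      using \<eta> \<tau>(1) e by (intro order_tendstoD) auto
    then show ?thesis
    proof eventually_elim
      case (elim k)
      have "hausdorff_close Z (f k ` ?B k) (g ` ?C) e"
        unfolding hausdorff_close_def
      proof (intro conjI ballI)
        fix a assume "a \<in> f k ` ?B k"
        then obtain x where x: "a = f k x" "x \<in> mspace (X k)" "mdist (X k) (p k) x \<le> \<epsilon> + 2 * \<eta> k"
          by auto
        then obtain z where z: "z \<in> mspace W" "mdist Z (f k x) (g z) < \<eta> k"
          using close[of k] unfolding hausdorff_close_def by auto
        have "mdist W q z = mdist Z (g q) (g z)"
          using g q z(1) by (simp add: isometric_embedding_def)
        also have "\<dots> \<le> mdist Z (f k (p k)) (g q) + mdist Z (f k (p k)) (f k x) + mdist Z (f k x) (g z)"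
          using mdist_triangle[of "g q" Z "f k (p k)" "g z"] mdist_triangle[of "f k (p k)" Z "f k x" "g z"]
            fZ[OF p] fZ[OF x(2)] gZ[OF q] gZ[OF z(1)] by (simp add: mdist_commute)
        also have "mdist Z (f k (p k)) (f k x) = mdist (X k) (p k) x"
          using f p x(2) by (simp add: isometric_embedding_def)
        finally have "z \<in> mcball_of W q (\<epsilon> + \<tau>)"
          using x(3) z centre[of k] elim q by simp
        then obtain w where w: "w \<in> ?C" "mdist W z w < e / 2" using \<tau>(2) by blast
        have "mdist Z (f k x) (g w) \<le> mdist Z (f k x) (g z) + mdist Z (g z) (g w)"
          using w fZ[OF x(2)] gZ z(1) by (intro mdist_triangle) auto
        also have "mdist Z (g z) (g w) = mdist W z w"
          using g z(1) w(1) by (simp add: isometric_embedding_def)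
        finally show "\<exists>b\<in>g ` ?C. mdist Z a b < e"
          using w z(2) elim x(1) by (intro bexI[of _ "g w"]) auto
      next
        fix b assume "b \<in> g ` ?C"
        then obtain w where w: "b = g w" "w \<in> mspace W" "mdist W q w \<le> \<epsilon>" by auto
        then obtain x where x: "x \<in> mspace (X k)" "mdist Z (f k x) (g w) < \<eta> k"
          using close[of k] unfolding hausdorff_close_def by auto
        have "mdist (X k) (p k) x = mdist Z (f k (p k)) (f k x)"
          using f p x(1) by (simp add: isometric_embedding_def)
        also have "\<dots> \<le> mdist Z (f k (p k)) (g q) + mdist Z (g q) (g w) + mdist Z (f k x) (g w)"
          using mdist_triangle[of "f k (p k)" Z "g q" "f k x"] mdist_triangle[of "g q" Z "g w" "f k x"]
            fZ[OF p] fZ[OF x(1)] gZ[OF q] gZ[OF w(2)] by (simp add: mdist_commute)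
        also have "mdist Z (g q) (g w) = mdist W q w"
          using g q w(2) by (simp add: isometric_embedding_def)
        finally have "x \<in> ?B k" using x w(3) centre[of k] p by simp
        then show "\<exists>a\<in>f k ` ?B k. mdist Z a b < e"
          using x(2) w(1) elim e by (intro bexI[of _ "f k x"]) auto
      qed
      moreover have "?B k \<inter> mspace (X k) = ?B k" "?C \<inter> mspace W = ?C" by auto
      ultimately show ?case
        by (intro gh_dist_le_if_close[where Z = Z and f = "f k" and g = g] isometric_embedding_submetric f g e) simp
    qed
  qed
  show ?thesis
  proof (rule order_tendstoI)
    fix a :: ennreal assume "0 < a"
    then obtain b where b: "0 < b" "b < a" using dense by blast
    obtain e where e: "0 < e" "ennreal e < a"
      using b by (cases b) auto
    from ev[OF e(1)] show "\<forall>\<^sub>F k in sequentially. gh_dist (submetric (X k) (?B k)) (submetric W ?C) < a"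
      by eventually_elim (rule le_less_trans[OF _ e(2)])
  qed simp
qed

section \<open>Completions and inner regions\<close>

lemma mspace_mcompletion [simp]: "mspace (mcompletion m) = completion_carrier m"
  and mdist_mcompletion [simp]: "mdist (mcompletion m) = completion_dist m"
  using Metric_space.mspace_metric[OF Metric_space_completion]
    Metric_space.mdist_metric[OF Metric_space_completion]
  by (auto simp: mcompletion_def)

lemma cauchy_rel_class_in_completion:
  assumes "Metric_space.MCauchy (mspace m) (mdist m) s"
  shows "cauchy_rel m `` {s} \<in> completion_carrier m" and "s \<in> cauchy_rel m `` {s}"
proof -
  show "cauchy_rel m `` {s} \<in> completion_carrier m"
    using assms by (auto simp: completion_carrier_def intro: quotientI)
  show "s \<in> cauchy_rel m `` {s}"
    using assms equiv_class_self[OF equiv_cauchy_rel, of s m] by simp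
qed

lemma MCauchy_constant: "x \<in> mspace m \<Longrightarrow> Metric_space.MCauchy (mspace m) (mdist m) (\<lambda>_. x)"
  by (simp add: Metric_space.MCauchy_const)

lemma isometric_embedding_to_completion: "isometric_embedding m (mcompletion m) (to_completion m)"
  unfolding isometric_embedding_def to_completion_def
proof (intro conjI ballI)
  show "(\<lambda>x. cauchy_rel m `` {\<lambda>_. x}) ` mspace m \<subseteq> mspace (mcompletion m)"
    using cauchy_rel_class_in_completion(1)[OF MCauchy_constant] by auto
next
  fix x y assume xy: "x \<in> mspace m" "y \<in> mspace m"
  have "(\<lambda>n. mdist m x y) \<longlonglongrightarrow> completion_dist m (cauchy_rel m `` {\<lambda>_. x}) (cauchy_rel m `` {\<lambda>_. y})"
    using completion_dist_lim[OF cauchy_rel_class_in_completion(1)[OF MCauchy_constant[OF xy(1)]]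
        cauchy_rel_class_in_completion(1)[OF MCauchy_constant[OF xy(2)]]
        cauchy_rel_class_in_completion(2)[OF MCauchy_constant[OF xy(1)]]
        cauchy_rel_class_in_completion(2)[OF MCauchy_constant[OF xy(2)]]] .
  then show "mdist (mcompletion m) (cauchy_rel m `` {\<lambda>_. x}) (cauchy_rel m `` {\<lambda>_. y}) = mdist m x y"
    by (simp add: LIMSEQ_const_iff)
qed

text \<open>A class in the completion of the subspace \<open>S\<close> is represented by a Cauchy sequence in \<open>S\<close>,
  whose far terms approximate it in every larger space.\<close>

lemma completion_incl_approx:
  assumes A: "A \<in> mspace (mcompletion (submetric m S))" and e: "0 < e"
  shows "completion_incl m A \<in> mspace (mcompletion m)"
    and "\<exists>x\<in>S \<inter> mspace m. mdist (mcompletion m) (completion_incl m A) (to_completion m x) < e"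
proof -
  interpret Submetric "mspace m" "mdist m" "S \<inter> mspace m"
    by (simp add: Submetric_def Submetric_axioms_def)
  from A obtain s where s: "Metric_space.MCauchy (S \<inter> mspace m) (mdist m) s"
      and As: "A = cauchy_rel (submetric m S) `` {s}"
    by (auto simp: completion_carrier_def elim!: quotientE)
  have sm: "MCauchy s" using s by (simp add: MCauchy_submetric)
  have sS: "s n \<in> S \<inter> mspace m" for n
    using s by (auto simp: MCauchy_submetric)
  have "A \<subseteq> cauchy_rel m `` {s}"
    unfolding As by (auto simp: cauchy_rel_def MCauchy_submetric)
  moreover have "s \<in> A"
    using cauchy_rel_class_in_completion(2)[of "submetric m S" s] s As by simp
  ultimately have incl: "completion_incl m A = cauchy_rel m `` {s}"
    unfolding completion_incl_def
    using equiv_cauchy_rel[of m] by (auto simp: equiv_def dest: symD transD)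
  note cl = cauchy_rel_class_in_completion[OF sm]
  show "completion_incl m A \<in> mspace (mcompletion m)"
    using cl(1) by (simp add: incl)
  obtain N where N: "\<And>n n'. N \<le> n \<Longrightarrow> N \<le> n' \<Longrightarrow> mdist m (s n) (s n') < e / 2"
    using sm e unfolding MCauchy_def by (meson half_gt_zero)
  have x: "s N \<in> mspace m" using sS by auto
  note cx = cauchy_rel_class_in_completion[OF MCauchy_constant[OF x]]
  have "(\<lambda>n. mdist m (s n) (s N)) \<longlonglongrightarrow> mdist (mcompletion m) (completion_incl m A) (to_completion m (s N))"
    using completion_dist_lim[OF cl(1) cx(1) cl(2) cx(2)] by (simp add: incl to_completion_def)
  then have "mdist (mcompletion m) (completion_incl m A) (to_completion m (s N)) \<le> e / 2"
    by (rule LIMSEQ_le_const2) (use N in \<open>force intro: less_imp_le\<close>)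
  with e sS show "\<exists>x\<in>S \<inter> mspace m. mdist (mcompletion m) (completion_incl m A) (to_completion m x) < e"
    by (intro bexI[of _ "s N"]) auto
qed

lemma to_completion_dense:
  assumes A: "A \<in> mspace (mcompletion m)" and e: "0 < e"
  shows "\<exists>x\<in>mspace m. mdist (mcompletion m) A (to_completion m x) < e"
proof -
  have "completion_incl m A = A"
  proof -
    from A obtain s where "Metric_space.MCauchy (mspace m) (mdist m) s" "A = cauchy_rel m `` {s}"
      by (auto simp: completion_carrier_def elim!: quotientE)
    then show ?thesis
      using cauchy_rel_class_in_completion(2)[of m s] equiv_cauchy_rel[of m]
      unfolding completion_incl_def equiv_def by (auto dest: symD transD)
  qed
  then show ?thesis using completion_incl_approx(2)[of A m UNIV, OF _ e] A by simp
qed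

text \<open>Limit embeddings are given on completions, whereas the balls in the conclusion consist of
  points of the manifolds. By density the change costs an arbitrarily small error.\<close>

lemma hausdorff_close_to_completion:
  assumes \<psi>: "isometric_embedding (mcompletion m) Z \<psi>" and B: "B \<subseteq> mspace Z" and r: "r < s"
    and close: "hausdorff_close Z (\<psi> ` mspace (mcompletion m)) B r"
  shows "hausdorff_close Z ((\<psi> \<circ> to_completion m) ` mspace m) B s"
  unfolding hausdorff_close_def
proof (intro conjI ballI)
  fix a assume "a \<in> (\<psi> \<circ> to_completion m) ` mspace m"
  then have "a \<in> \<psi> ` mspace (mcompletion m)"
    using isometric_embedding_to_completion[of m] by (auto simp: isometric_embedding_def)
  then obtain b where "b \<in> B" "mdist Z a b < r"
    using close unfolding hausdorff_close_def by blast
  with r show "\<exists>b\<in>B. mdist Z a b < s" by force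
next
  fix b assume b: "b \<in> B"
  then obtain A where A: "A \<in> mspace (mcompletion m)" "mdist Z (\<psi> A) b < r"
    using close unfolding hausdorff_close_def by blast
  obtain x where x: "x \<in> mspace m" "mdist (mcompletion m) A (to_completion m x) < s - r"
    using to_completion_dense[OF A(1), of "s - r"] r by auto
  have tx: "to_completion m x \<in> mspace (mcompletion m)"
    using isometric_embedding_to_completion[of m] x(1) by (auto simp: isometric_embedding_def)
  have "mdist Z (\<psi> (to_completion m x)) b \<le> mdist Z (\<psi> (to_completion m x)) (\<psi> A) + mdist Z (\<psi> A) b"
    using \<psi> B A(1) tx b by (intro mdist_triangle) (auto simp: isometric_embedding_def)
  also have "mdist Z (\<psi> (to_completion m x)) (\<psi> A) = mdist (mcompletion m) A (to_completion m x)"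
    using \<psi> A(1) tx unfolding isometric_embedding_def by (metis mdist_commute)
  finally show "\<exists>a\<in>(\<psi> \<circ> to_completion m) ` mspace m. mdist Z a b < s"
    using x A(2) by (intro bexI[of _ "\<psi> (to_completion m x)"]) auto
qed

text \<open>The distance to the boundary is 1-Lipschitz. Without boundary, every inner region is the whole
  space.\<close>

lemma mcball_subset_inner_region:
  assumes p: "p \<in> inner_region m \<delta>" and e: "\<delta>' + e \<le> \<delta>"
  shows "mcball_of m p e \<subseteq> inner_region m \<delta>'"
proof
  fix x assume x: "x \<in> mcball_of m p e"
  let ?D = "\<lambda>x. INF b\<in>mboundary m. mdist (mcompletion m) (to_completion m x) b"
  show "x \<in> inner_region m \<delta>'"
  proof (cases "mboundary m = {}")
    case True
    with x show ?thesis by (simp add: inner_region_def)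
  next
    case False
    then have Dp: "\<delta> < ?D p" using p by (simp add: inner_region_def)
    have "?D p - e \<le> ?D x"
    proof (rule cINF_greatest[OF False])
      fix b assume b: "b \<in> mboundary m"
      have mem: "to_completion m p \<in> mspace (mcompletion m)" "to_completion m x \<in> mspace (mcompletion m)"
        "b \<in> mspace (mcompletion m)"
        using x b isometric_embedding_to_completion[of m]
        by (auto simp: isometric_embedding_def mboundary_def)
      have "?D p \<le> mdist (mcompletion m) (to_completion m p) b"
        using b by (intro cINF_lower bdd_belowI2[of _ 0]) (auto simp del: mdist_mcompletion)
      also have "\<dots> \<le> mdist (mcompletion m) (to_completion m p) (to_completion m x) +
                   mdist (mcompletion m) (to_completion m x) b"
        using mem by (rule mdist_triangle)
      also have "mdist (mcompletion m) (to_completion m p) (to_completion m x) = mdist m p x"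
        using x isometric_embedding_to_completion[of m] by (simp add: isometric_embedding_def)
      finally show "?D p - e \<le> mdist (mcompletion m) (to_completion m x) b"
        using x by simp
    qed
    with Dp e x show ?thesis by (simp add: inner_region_def)
  qed
qed

lemma inner_region_antimono:
  assumes "\<delta>' \<le> \<delta>" shows "inner_region m \<delta> \<subseteq> inner_region m \<delta>'"
  using assms by (auto simp: inner_region_def)

section \<open>Canonical embeddings into the glued space\<close>

lemma isometric_embedding_canonical_embedding:
  assumes iso: "\<And>i. isometric_embedding (Y i) (Y (Suc i)) (\<phi> i)"
  shows "isometric_embedding (Y i) (glued_space Y \<phi>) (canonical_embedding Y \<phi> i)"
proof -
  note ic = isometric_embedding_connecting[of Y \<phi>, OF iso]
  \<comment> \<open>The canonical embedding records the earliest space from which a point of \<open>Y i\<close> comes.\<close>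
  have origin: "\<exists>a\<le>i. \<exists>x. canonical_embedding Y \<phi> i y = (a, x) \<and> (a, x) \<in> glued_carrier Y \<phi> \<and>
      x \<in> mspace (Y a) \<and> connecting \<phi> i a x = y" if "y \<in> mspace (Y i)" for i y
    using that
  proof (induction i arbitrary: y)
    case 0
    then show ?case by (simp add: glued_carrier_def)
  next
    case (Suc i)
    show ?case
    proof (cases "y \<in> \<phi> i ` mspace (Y i)")
      case True
      let ?z = "inv_into (mspace (Y i)) (\<phi> i) y"
      have z: "?z \<in> mspace (Y i)" "\<phi> i ?z = y"
        using True by (auto intro: inv_into_into f_inv_into_f)
      obtain a x where "a \<le> i" "canonical_embedding Y \<phi> i ?z = (a, x)" "(a, x) \<in> glued_carrier Y \<phi>"
          "x \<in> mspace (Y a)" "connecting \<phi> i a x = ?z"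
        using Suc.IH[OF z(1)] by blast
      with True z(2) show ?thesis by (intro exI[of _ a]) auto
    next
      case False
      with Suc.prems show ?thesis by (intro exI[of _ "Suc i"]) (auto simp: glued_carrier_def)
    qed
  qed
  have glued: "Metric_space (glued_carrier Y \<phi>) (glued_dist Y \<phi>)"
    using iso by (rule Metric_space_glued)
  have sp: "mspace (glued_space Y \<phi>) = glued_carrier Y \<phi>" "mdist (glued_space Y \<phi>) = glued_dist Y \<phi>"
    using Metric_space.mspace_metric[OF glued]
      Metric_space.mdist_metric[OF glued] by (auto simp: glued_space_def)
  have dist: "glued_dist Y \<phi> (a, x) (b, x') = mdist (Y i) (connecting \<phi> i a x) (connecting \<phi> i b x')"
    if "b \<le> a" "a \<le> i" "x \<in> mspace (Y a)" "x' \<in> mspace (Y b)" for a b x x'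
  proof -
    have "connecting \<phi> a b x' \<in> mspace (Y a)"
      using ic[OF that(1)] that(4) by (auto simp: isometric_embedding_def)
    then have "mdist (Y i) (connecting \<phi> i a x) (connecting \<phi> i a (connecting \<phi> a b x')) =
        mdist (Y a) x (connecting \<phi> a b x')"
      using ic[OF that(2)] that(3) by (simp add: isometric_embedding_def)
    then show ?thesis using that(1,2) by (simp add: glued_dist_def connecting_trans)
  qed
  show ?thesis
    unfolding isometric_embedding_def sp
  proof (intro conjI ballI)
    show "canonical_embedding Y \<phi> i ` mspace (Y i) \<subseteq> glued_carrier Y \<phi>"
    proof
      fix p assume "p \<in> canonical_embedding Y \<phi> i ` mspace (Y i)"
      then show "p \<in> glued_carrier Y \<phi>" using origin[of _ i] by fastforce
    qed
  next
    fix y y' assume y: "y \<in> mspace (Y i)" and y': "y' \<in> mspace (Y i)"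
    obtain a x where a: "a \<le> i" "canonical_embedding Y \<phi> i y = (a, x)"
        "x \<in> mspace (Y a)" "connecting \<phi> i a x = y" using origin[OF y] by blast
    obtain b x' where b: "b \<le> i" "canonical_embedding Y \<phi> i y' = (b, x')"
        "x' \<in> mspace (Y b)" "connecting \<phi> i b x' = y'" using origin[OF y'] by blast
    have "glued_dist Y \<phi> (a, x) (b, x') = mdist (Y i) y y'"
    proof (cases "b \<le> a")
      case True
      then show ?thesis using dist[OF True a(1,3) b(3)] a b by simp
    next
      case False
      then have "glued_dist Y \<phi> (b, x') (a, x) = mdist (Y i) y' y"
        using dist[of a b x' x] a b by simp
      then show ?thesis
        using Metric_space.commute[OF glued] by (metis mdist_commute)
    qed
    then show "glued_dist Y \<phi> (canonical_embedding Y \<phi> i y) (canonical_embedding Y \<phi> i y') = mdist (Y i) y y'"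
      using a b by simp
  qed
qed

lemma canonical_embedding_Suc_image:
  assumes "isometric_embedding (Y i) (Y (Suc i)) (\<phi> i)" and "y \<in> mspace (Y i)"
  shows "canonical_embedding Y \<phi> (Suc i) (\<phi> i y) = canonical_embedding Y \<phi> i y"
  using assms isometric_embedding_inj_on[OF assms(1)] by simp

lemma isometric_embedding_image_mcball:
  assumes f: "isometric_embedding X Y f" and q: "q \<in> mspace X"
  shows "f ` mcball_of X q e = mcball_of Y (f q) e \<inter> f ` mspace X"
  using f q by (auto simp: isometric_embedding_def image_subset_iff)

section \<open>Balls in glued limit spaces\<close>

lemma strict_mono_diagonal:
  assumes "\<And>n. \<forall>\<^sub>F k in sequentially. P n (k :: nat)"
  shows "\<exists>r. strict_mono r \<and> (\<forall>n :: nat. P n (r n))"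
proof -
  have ex: "\<exists>k>N. P n k" for n N
    using eventually_happens[OF eventually_conj[OF eventually_gt_at_top[of N] assms[of n]]] by auto
  have "\<exists>r. \<forall>n. P n (r n) \<and> r n < r (Suc n)"
    by (rule dependent_nat_choice) (use ex in blast)+
  then show ?thesis by (auto simp: strict_mono_Suc_iff)
qed

theorem theorem8p3:
  fixes M :: "nat \<Rightarrow> 'a riemannian"
    and \<delta> :: "nat \<Rightarrow> real"
    and Y :: "real \<Rightarrow> 'y metric"
    and \<phi> :: "nat \<Rightarrow> 'y \<Rightarrow> 'y"
    and i :: nat and y :: 'y and \<epsilon> :: real
  defines "d \<equiv> \<lambda>j. length_metric (M j)"
    and "G \<equiv> glued_space (\<lambda>n. Y (\<delta> n)) \<phi>"
    and "F \<equiv> canonical_embedding (\<lambda>n. Y (\<delta> n)) \<phi>"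
  assumes "\<And>j. open_riemannian_manifold (M j)"
    and "\<And>n. 0 < \<delta> n" and "decseq \<delta>" and "\<delta> \<longlonglongrightarrow> 0"
    and "\<And>n. compact_space (mtopology_of (Y (\<delta> n)))"
    and "\<And>n. (\<lambda>j. gh_dist (inner_completion (d j) (\<delta> n)) (Y (\<delta> n))) \<longlonglongrightarrow> 0"
    and "\<And>n. subsequential_limit_embedding TYPE('z) d Y (\<delta> (Suc n)) (\<delta> n) (\<phi> n)"
    and "y \<in> mspace (Y (\<delta> i))"
    and "0 < \<epsilon>" and "\<epsilon> < \<delta> i - \<delta> (Suc i)"
  shows "\<exists>(r :: nat \<Rightarrow> nat) (p :: nat \<Rightarrow> 'a) (e :: nat \<Rightarrow> real).
     strict_mono r \<and>
     (\<forall>k. p k \<in> inner_region (d (r k)) (\<delta> i)) \<and>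
     e \<longlonglongrightarrow> \<epsilon> \<and>
     (\<forall>k. mball_of (d (r k)) (p k) (e k) \<subseteq> inner_region (d (r k)) (\<delta> (Suc i))) \<and>
     (\<lambda>k. gh_dist
        (submetric (d (r k)) (mcball_of (d (r k)) (p k) (e k)))
        (submetric G (mcball_of G (F i y) \<epsilon> \<inter> F (Suc i) ` mspace (Y (\<delta> (Suc i)))))) \<longlonglongrightarrow> 0"
proof -
  let ?W = "Y (\<delta> (Suc i))" and ?S = "\<lambda>j. inner_region (d j) (\<delta> (Suc i))"
    and ?T = "\<lambda>j. inner_region (d j) (\<delta> i)"
  let ?X = "\<lambda>j. submetric (d j) (?S j)"
  define gap where "gap = \<delta> i - \<delta> (Suc i) - \<epsilon>"
  \<comment> \<open>All errors at stage \<open>n\<close> will be below this number, and the factor makes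
      \<open>\<epsilon> + 2 * \<eta> n\<close> at most \<open>\<delta> i - \<delta> (Suc i)\<close> already for \<open>n = 0\<close>.\<close>
  define \<eta> where "\<eta> n = gap / 2 * inverse (real (Suc n))" for n
  have gap: "0 < gap" using assms by (simp add: gap_def)
  then have \<eta>_pos: "0 < \<eta> n" for n by (simp add: \<eta>_def)
  have \<eta>_lim: "\<eta> \<longlonglongrightarrow> 0"
    unfolding \<eta>_def using tendsto_mult_right_zero[OF LIMSEQ_inverse_real_of_nat] by blast
  have \<eta>_gap: "2 * \<eta> n \<le> gap" for n
    using gap by (simp add: \<eta>_def field_simps)
  have iso: "isometric_embedding (Y (\<delta> n)) (Y (\<delta> (Suc n))) (\<phi> n)" for n
    using assms(10)[of n] by (simp add: subsequential_limit_embedding_def)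
  have \<phi>y: "\<phi> i y \<in> mspace ?W"
    using iso[of i] \<open>y \<in> mspace (Y (\<delta> i))\<close> by (auto simp: isometric_embedding_def)
  have "\<delta> (Suc i) \<noteq> \<delta> i" using assms by simp
  then obtain Z :: "'z metric" and \<psi> \<psi>' s where
    \<psi>: "\<And>j. isometric_embedding (mcompletion (?X j)) Z (\<psi> j)"
    and \<psi>': "isometric_embedding ?W Z \<psi>'"
    and lim: "(\<lambda>j. hausdorff_dist Z (\<psi> j ` mspace (mcompletion (?X j))) (\<psi>' ` mspace ?W)) \<longlonglongrightarrow> 0"
    and s: "strict_mono (s :: nat \<Rightarrow> nat)"
    and lim': "(\<lambda>k. hausdorff_dist Z
        (\<psi> (s k) ` completion_incl (?X (s k)) ` mspace (mcompletion (submetric (d (s k)) (?T (s k)))))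
        (\<psi>' ` \<phi> i ` mspace (Y (\<delta> i)))) \<longlonglongrightarrow> 0"
    using assms(10)[of i] unfolding subsequential_limit_embedding_def inner_completion_def by auto
  have TS: "?T j \<subseteq> ?S j" for j
    using \<open>decseq \<delta>\<close> by (intro inner_region_antimono) (simp add: decseq_Suc_iff)
  \<comment> \<open>The completed inner region of depth \<open>\<delta> i\<close> becomes the completion of a subspace of \<open>?X j\<close>.\<close>
  have TX: "submetric (d j) (?T j) = submetric (?X j) (?T j)" for j
    using TS[of j] by (simp add: inf.absorb2)
  let ?f = "\<lambda>j. \<psi> j \<circ> to_completion (?X j)"
  have f: "isometric_embedding (?X j) Z (?f j)" for j
    using isometric_embedding_to_completion \<psi> by (rule isometric_embedding_compose)
  have ev: "\<forall>\<^sub>F k in sequentially. hausdorff_close Z (?f (s k) ` mspace (?X (s k))) (\<psi>' ` mspace ?W) (\<eta> n) \<and>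
      (\<exists>p\<in>?T (s k). mdist Z (?f (s k) p) (\<psi>' (\<phi> i y)) < \<eta> n)" for n
  proof -
    have half: "0 < \<eta> n / 2" using \<eta>_pos[of n] by simp
    have "\<forall>\<^sub>F k in sequentially. hausdorff_close Z (\<psi> (s k) ` mspace (mcompletion (?X (s k)))) (\<psi>' ` mspace ?W) (\<eta> n / 2)"
      using eventually_hausdorff_close[OF LIMSEQ_subseq_LIMSEQ[OF lim s, unfolded o_def] half] .
    then show ?thesis
      using eventually_hausdorff_close[OF lim' half]
    proof eventually_elim
      case (elim k)
      let ?m = "?X (s k)"
      have close: "hausdorff_close Z (?f (s k) ` mspace ?m) (\<psi>' ` mspace ?W) (\<eta> n)"
        using \<psi>' half by (intro hausdorff_close_to_completion[OF \<psi> _ _ elim(1)]) (auto simp: isometric_embedding_def)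
      obtain A where A: "A \<in> mspace (mcompletion (submetric ?m (?T (s k))))"
          "mdist Z (\<psi> (s k) (completion_incl ?m A)) (\<psi>' (\<phi> i y)) < \<eta> n / 2"
        using elim(2) \<open>y \<in> mspace (Y (\<delta> i))\<close> unfolding hausdorff_close_def TX by blast
      obtain p where p: "p \<in> ?T (s k) \<inter> mspace ?m"
          "mdist (mcompletion ?m) (completion_incl ?m A) (to_completion ?m p) < \<eta> n / 2"
        using completion_incl_approx(2)[OF A(1) half] by blast
      have mem: "completion_incl ?m A \<in> mspace (mcompletion ?m)" "to_completion ?m p \<in> mspace (mcompletion ?m)"
        using completion_incl_approx(1)[OF A(1) half] isometric_embedding_to_completion[of ?m] p(1)
        by (auto simp: isometric_embedding_def)
      have "mdist Z (?f (s k) p) (\<psi>' (\<phi> i y)) \<le>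
          mdist Z (?f (s k) p) (\<psi> (s k) (completion_incl ?m A)) + mdist Z (\<psi> (s k) (completion_incl ?m A)) (\<psi>' (\<phi> i y))"
        using \<psi>[of "s k"] \<psi>' mem \<phi>y unfolding o_def
        by (intro mdist_triangle) (auto simp: isometric_embedding_def simp del: mspace_mcompletion)
      also have "mdist Z (?f (s k) p) (\<psi> (s k) (completion_incl ?m A)) =
          mdist (mcompletion ?m) (completion_incl ?m A) (to_completion ?m p)"
        using \<psi>[of "s k"] mem unfolding isometric_embedding_def o_def by (metis mdist_commute)
      finally have "mdist Z (?f (s k) p) (\<psi>' (\<phi> i y)) < \<eta> n" using A(2) p(2) by simp
      with close p(1) show ?case by blast
    qed
  qed
  \<comment> \<open>A diagonal subsequence makes the errors at stage \<open>n\<close> smaller than the explicit \<open>\<eta> n\<close>.\<close>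
  obtain t where t: "strict_mono t"
      "\<And>n. hausdorff_close Z (?f (s (t n)) ` mspace (?X (s (t n)))) (\<psi>' ` mspace ?W) (\<eta> n)"
      "\<And>n. \<exists>p\<in>?T (s (t n)). mdist Z (?f (s (t n)) p) (\<psi>' (\<phi> i y)) < \<eta> n"
    using strict_mono_diagonal[of "\<lambda>n k. hausdorff_close Z (?f (s k) ` mspace (?X (s k))) (\<psi>' ` mspace ?W) (\<eta> n) \<and>
      (\<exists>p\<in>?T (s k). mdist Z (?f (s k) p) (\<psi>' (\<phi> i y)) < \<eta> n)", OF ev] by blast
  define r where "r = s \<circ> t"
  have r: "strict_mono r" unfolding r_def using s t(1) by (rule strict_mono_o)
  have close: "hausdorff_close Z (?f (r n) ` mspace (?X (r n))) (\<psi>' ` mspace ?W) (\<eta> n)" for n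
    using t(2) by (simp add: r_def)
  obtain p where p: "\<And>n. p n \<in> ?T (r n)" "\<And>n. mdist Z (?f (r n) (p n)) (\<psi>' (\<phi> i y)) < \<eta> n"
    using t(3) unfolding r_def o_apply by metis
  let ?e = "\<lambda>n. \<epsilon> + 2 * \<eta> n"
  have "?e \<longlonglongrightarrow> \<epsilon> + 2 * 0" by (intro tendsto_intros \<eta>_lim)
  then have e: "?e \<longlonglongrightarrow> \<epsilon>" by simp
  have inside: "mcball_of (d (r k)) (p k) (?e k) \<subseteq> ?S (r k)" for k
    using \<eta>_gap[of k] by (intro mcball_subset_inner_region[OF p(1)]) (simp add: gap_def)
  have pX: "p k \<in> mspace (?X (r k))" for k
    using p(1)[of k] TS[of "r k"] by (auto simp: inner_region_def)
  have ball: "submetric (?X (r k)) (mcball_of (?X (r k)) (p k) (?e k)) =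
      submetric (d (r k)) (mcball_of (d (r k)) (p k) (?e k))" for k
  proof -
    have "?S (r k) \<inter> mcball_of (?X (r k)) (p k) (?e k) = mcball_of (d (r k)) (p k) (?e k)"
      using inside[of k] pX[of k] by auto
    then show ?thesis by simp
  qed
  let ?B = "mcball_of ?W (\<phi> i y) \<epsilon>" and ?C = "mcball_of G (F i y) \<epsilon> \<inter> F (Suc i) ` mspace ?W"
  have "isometric_embedding ?W G (F (Suc i))"
    unfolding G_def F_def using isometric_embedding_canonical_embedding[of "\<lambda>n. Y (\<delta> n)", OF iso] .
  moreover have "F (Suc i) (\<phi> i y) = F i y"
    unfolding F_def by (rule canonical_embedding_Suc_image) (use iso assms in auto)
  ultimately have F: "isometric_embedding ?W G (F (Suc i))" "F (Suc i) ` ?B = ?C"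
    using isometric_embedding_image_mcball[of ?W G "F (Suc i)" "\<phi> i y" \<epsilon>] \<phi>y by auto
  have sub: "?B \<inter> mspace ?W = ?B" "?C \<inter> mspace G = ?C" by auto
  have "isometric_embedding (submetric ?W ?B) (submetric G ?C) (F (Suc i))"
    using F unfolding isometric_embedding_def mspace_submetric mdist_submetric sub by auto
  then have le: "gh_dist X (submetric G ?C) \<le> gh_dist X (submetric ?W ?B)" for X :: "'a metric"
    by (rule gh_dist_le_isometric_image) (use F(2) sub in simp)
  have "(\<lambda>k. gh_dist (submetric (d (r k)) (mcball_of (d (r k)) (p k) (?e k))) (submetric ?W ?B)) \<longlonglongrightarrow> 0"
    using gh_dist_mcballs_tendsto_0[where X = "\<lambda>k. ?X (r k)" and \<epsilon> = \<epsilon>, OF assms(8) f \<psi>' pX \<phi>y \<eta>_lim p(2) close]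
    unfolding ball .
  then have "(\<lambda>k. gh_dist (submetric (d (r k)) (mcball_of (d (r k)) (p k) (?e k))) (submetric G ?C)) \<longlonglongrightarrow> 0"
    by (rule tendsto_sandwich[OF _ _ tendsto_const, rotated 2]) (auto simp: le simp del: mspace_submetric)
  moreover have "mball_of (d (r k)) (p k) (?e k) \<subseteq> ?S (r k)" for k
    using inside[of k] by fastforce
  ultimately show ?thesis
    using r p(1) e by blast
qed

end
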